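(* Let $\mathcal{C}$ be the unit circle centered at the origin of the $xy$-plane in $\mathbb{R}^3$, with constant density $\lambda>0$ and potential $V(\mathbf{r})=-\int_{\mathcal{C}}\frac{\lambda\,du}{\|\mathbf{r}-u\|}$. Write $V(r)=V(r\mathbf{u})$ for any unit vector $\mathbf{u}$ in the $xy$-plane, and for $K\in\mathbb{R}$ let $U(r)=\frac{K^2}{2r^2}+V(r)$ be the effective potential inside the circle, defined for $0<r<1$ if $K\neq 0$ and for $-1<r<1$ if $K=0$ (in which case $U=V$). Then: (i) $\frac{d}{dr}V(r)<0$ for $0<r<1$; hence $\frac{d}{dr}U(r)<0$ for $0<r<1$. (ii) $\lim_{r\to 1^-}U(r)=-\infty$. (iii) For $K\neq 0$, $\lim_{r\to 0^+}U(r)=+\infty$. (iv) For $K=0$, the function $U(r)$, $-1<r<1$, is even.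
   Context: $du$ denotes arc length on $\mathcal{C}$. By rotational symmetry about the $z$-axis, $V(r\mathbf{u})$ does not depend on the choice of the unit vector $\mathbf{u}$ in the $xy$-plane. The constant $K$ is the angular momentum of a planar solution of $\ddot{\mathbf{r}}=-\nabla V(\mathbf{r})$. *)

theory Defs
  imports "HOL-Analysis.Analysis"
begin

definition arclength_integral ::
    "real \<Rightarrow> real \<Rightarrow> (real \<Rightarrow> 'a::euclidean_space) \<Rightarrow> ('a \<Rightarrow> real) \<Rightarrow> real" where
  "arclength_integral a b \<gamma> f =
     integral {a..b} (\<lambda>t. f (\<gamma> t) * norm (vector_derivative \<gamma> (at t within {a..b})))"

definition circle_param :: "real \<Rightarrow> real ^ 3" where
  "circle_param t = vector [cos t, sin t, 0]"

lemma circle_param_image: "circle_param ` {0..2 * pi} = {p. norm p = 1 \<and> p $ 3 = 0}"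
proof (intro set_eqI iffI)
  fix p assume "p \<in> circle_param ` {0..2 * pi}"
  then show "p \<in> {p. norm p = 1 \<and> p $ 3 = 0}"
    by (auto simp: circle_param_def norm_vec_def L2_set_def sum_3)
next
  fix p :: "real ^ 3" assume "p \<in> {p. norm p = 1 \<and> p $ 3 = 0}"
  then have p: "(p $ 1)\<^sup>2 + (p $ 2)\<^sup>2 = 1" "p $ 3 = 0"
    by (auto simp: norm_vec_def L2_set_def sum_3)
  obtain t where t: "0 \<le> t" "t < 2 * pi" "p $ 1 = cos t" "p $ 2 = sin t"
    using sincos_total_2pi[OF p(1)] by metis
  then have "p = circle_param t"
    using p(2) by (simp add: circle_param_def vec_eq_iff forall_3)
  then show "p \<in> circle_param ` {0..2 * pi}"
    using t by auto
qed

lemma circle_param_inj: "inj_on circle_param {0..<2 * pi}"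
proof (rule inj_onI)
  fix s t assume st: "s \<in> {0..<2 * pi}" "t \<in> {0..<2 * pi}" "circle_param s = circle_param t"
  then have "sin s = sin t \<and> cos s = cos t"
    by (simp add: circle_param_def vec_eq_iff forall_3)
  then obtain n :: int where n: "s = t + 2 * pi * n"
    by (auto simp: sin_cos_eq_iff)
  have "\<bar>2 * pi * of_int n\<bar> < 2 * pi * 1"
    using st n by auto
  then have "\<bar>real_of_int n\<bar> < 1"
    by (simp add: abs_mult)
  then have "n = 0" by linarith
  then show "s = t" using n by simp
qed

definition ring_potential :: "real \<Rightarrow> real ^ 3 \<Rightarrow> real" where
  "ring_potential lam p = - arclength_integral 0 (2 * pi) circle_param (\<lambda>q. lam / norm (p - q))"

definition radial_potential :: "real \<Rightarrow> real ^ 3 \<Rightarrow> real \<Rightarrow> real" where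
  "radial_potential lam u r = ring_potential lam (r *\<^sub>R u)"

text \<open>For \<open>K \<noteq> 0\<close> only the values at \<open>0 < r < 1\<close> are meaningful. For \<open>K = 0\<close> the first
  summand vanishes everywhere, also at \<open>r = 0\<close> since \<open>0 / 0 = 0\<close>, so the effective potential
  is the radial potential on \<open>-1 < r < 1\<close>.\<close>

definition effective_potential :: "real \<Rightarrow> real \<Rightarrow> real ^ 3 \<Rightarrow> real \<Rightarrow> real" where
  "effective_potential lam K u r = K\<^sup>2 / (2 * r\<^sup>2) + radial_potential lam u r"

end

theory Submission
  imports Defs
begin

text \<open>
  By rotational symmetry the potential at distance \<open>r < 1\<close> from the centre is \<open>- lam * I r\<close>, where
  \<open>I r\<close> is the integral of \<open>1 / \<rho>\<close> over one turn and
  \<open>\<rho>\<^sup>2 = 1 - 2 * r * cos t + r\<^sup>2\<close> (lemma \<open>radial_potential_eq\<close>). Everything follows from the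
  behaviour of the function \<open>I\<close>.

  Differentiating under the integral gives \<open>I' r = \<integral> (cos t - r) / \<rho>\<^sup>3\<close>. The integrand
  changes sign: the pull of the near arc competes with that of the far arc. What decides the
  competition is a boundary term that vanishes. Seen from the point \<open>(r, 0)\<close>, the direction of the
  point at angle \<open>t\<close> on the circle has sine \<open>sin t / \<rho>\<close>, which is a periodic function of \<open>t\<close> with
  derivative \<open>(cos t - r) * (1 - r * cos t) / \<rho>\<^sup>3\<close>. Its integral over one turn is zero, and since
  \<open>1 - r * cos t = (1 - r\<^sup>2) - r * (cos t - r)\<close> this says
  \<open>(1 - r\<^sup>2) * I' r = r * \<integral> (cos t - r)\<^sup>2 / \<rho>\<^sup>3\<close>, with a nonnegative integrand on the right
  (lemma \<open>integral_radial_field_identity\<close>). So \<open>I' r > 0\<close> for \<open>0 < r < 1\<close>.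

  Near the circle, \<open>\<rho>\<close> is at most the way along the radius plus the way along the arc,
  \<open>\<rho> \<le> (1 - r) + t\<close>, so \<open>I r\<close> grows at least like \<open>- ln (1 - r)\<close>
  (lemma \<open>inverse_distance_integral_ge_ln\<close>). At the centre \<open>I\<close> is differentiable, hence bounded nearby,
  so the centrifugal term dominates there. Evenness is the symmetry again: the point \<open>- r\<close> in the
  direction \<open>u\<close> is the point \<open>r\<close> in the direction \<open>- u\<close>.
\<close>

section \<open>Integrals of periodic functions\<close>

text \<open>
  Cutting the shifted period \<open>{-a..p - a}\<close> at \<open>0\<close> and moving the piece left of \<open>0\<close> by \<open>p\<close> to the
  right reassembles \<open>{0..p}\<close>.
\<close>

lemma integral_periodic_shift:
  fixes f :: "real \<Rightarrow> real"
  assumes cont: "continuous_on UNIV f" and per: "\<And>t. f (t + p) = f t"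
    and a: "0 \<le> a" "a \<le> p"
  shows "integral {0..p} (\<lambda>t. f (t - a)) = integral {0..p} f"
proof -
  have int: "f integrable_on {c..d}" for c d
    by (intro integrable_continuous_real continuous_on_subset[OF cont]) simp
  have move: "integral {c..d} (\<lambda>t. f (t + s)) = integral {c + s..d + s} f" for c d s
  proof -
    have "(f has_integral integral {c + s..d + s} f) (cbox (c + s) (d + s))"
      using int by (simp add: integrable_integral)
    then have "((f \<circ> (+) s) has_integral integral {c + s..d + s} f) (cbox c d)"
      by (simp only: has_integral_shift_cbox_iff)
    then show ?thesis
      by (intro integral_unique) (simp add: o_def add.commute)
  qed
  have "integral {0..p} (\<lambda>t. f (t - a)) = integral {-a..p - a} f"
    using move[of 0 p "-a"] by simp
  also have "\<dots> = integral {-a..0} f + integral {0..p - a} f"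
    using a int by (simp add: Henstock_Kurzweil_Integration.integral_combine)
  also have "integral {-a..0} f = integral {p - a..p} f"
    using move[of "-a" 0 p] per by simp
  also have "integral {p - a..p} f + integral {0..p - a} f = integral {0..p} f"
    using a int by (simp add: Henstock_Kurzweil_Integration.integral_combine add.commute)
  finally show ?thesis .
qed

section \<open>The distance to a point of the circle\<close>

text \<open>
  The law of cosines for the triangle formed by the centre, a point at distance \<open>r\<close> from it and the
  point of the unit circle at angle \<open>t\<close> from the direction of the first. A negative \<open>r\<close> stands for
  the opposite direction.
\<close>

definition circle_dist :: "real \<Rightarrow> real \<Rightarrow> real" where
  "circle_dist r t = sqrt (1 - 2 * r * cos t + r\<^sup>2)"

definition inverse_distance_integral :: "real \<Rightarrow> real" where
  "inverse_distance_integral r = integral {0..2 * pi} (\<lambda>t. 1 / circle_dist r t)"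

lemma circle_dist_square_pos:
  fixes r t :: real
  assumes "\<bar>r\<bar> < 1"
  shows "0 < 1 - 2 * r * cos t + r\<^sup>2"
proof -
  have "r * cos t \<le> \<bar>r\<bar> * \<bar>cos t\<bar>"
    using abs_ge_self[of "r * cos t"] by (simp add: abs_mult)
  also have "\<dots> \<le> \<bar>r\<bar>"
    using mult_left_le[of "\<bar>cos t\<bar>" "\<bar>r\<bar>"] by simp
  finally have "r * cos t \<le> \<bar>r\<bar>" .
  moreover have "0 < (1 - \<bar>r\<bar>)\<^sup>2"
    using assms by simp
  ultimately show ?thesis
    by (simp add: power2_eq_square algebra_simps)
qed

lemma circle_dist_pos: "\<bar>r\<bar> < 1 \<Longrightarrow> 0 < circle_dist r t"
  using circle_dist_square_pos[of r t] by (simp add: circle_dist_def)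

lemma circle_dist_nonzero: "\<bar>r\<bar> < 1 \<Longrightarrow> circle_dist r t \<noteq> 0"
  using circle_dist_pos[of r t] by simp

lemma circle_dist_square:
  "\<bar>r\<bar> < 1 \<Longrightarrow> (circle_dist r t)\<^sup>2 = 1 - 2 * r * cos t + r\<^sup>2"
  using circle_dist_square_pos[of r t] by (simp add: circle_dist_def)

lemma continuous_on_circle_dist [continuous_intros]:
  fixes S :: "'a::t2_space set"
  assumes "continuous_on S f" "continuous_on S g"
  shows "continuous_on S (\<lambda>x. circle_dist (f x) (g x))"
  unfolding circle_dist_def by (intro continuous_on_real_sqrt continuous_on_add continuous_on_diff continuous_on_mult
      continuous_on_power continuous_on_const continuous_on_cos assms)

lemma half_inverse_mult_double: "inverse s / 2 * (2 * d) = d / (s :: real)"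
  by (simp add: field_simps)

lemma circle_dist_deriv_radius:
  assumes "\<bar>r\<bar> < 1"
  shows "((\<lambda>r. circle_dist r t) has_real_derivative (r - cos t) / circle_dist r t) (at r within S)"
proof -
  have "((\<lambda>r. 1 - 2 * r * cos t + r\<^sup>2) has_real_derivative 2 * (r - cos t)) (at r within S)"
    by (auto intro!: derivative_eq_intros)
  from DERIV_chain2[OF DERIV_real_sqrt[OF circle_dist_square_pos[OF assms]] this]
  show ?thesis
    unfolding circle_dist_def by (rule DERIV_cong) (rule half_inverse_mult_double)
qed

lemma circle_dist_deriv_angle:
  assumes "\<bar>r\<bar> < 1"
  shows "((\<lambda>t. circle_dist r t) has_real_derivative r * sin t / circle_dist r t) (at t within S)"
proof -
  have "((\<lambda>t. 1 - 2 * r * cos t + r\<^sup>2) has_real_derivative 2 * (r * sin t)) (at t within S)"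
    by (auto intro!: derivative_eq_intros)
  from DERIV_chain2[OF DERIV_real_sqrt[OF circle_dist_square_pos[OF assms]] this]
  show ?thesis
    unfolding circle_dist_def by (rule DERIV_cong) (rule half_inverse_mult_double)
qed

lemma norm_scaleR_circle_param_minus:
  "norm (r *\<^sub>R circle_param a - circle_param t) = circle_dist r (t - a)"
proof -
  have "(r * cos a - cos t)\<^sup>2 + (r * sin a - sin t)\<^sup>2
      = r\<^sup>2 * ((sin a)\<^sup>2 + (cos a)\<^sup>2) + ((sin t)\<^sup>2 + (cos t)\<^sup>2) - 2 * r * (cos t * cos a + sin t * sin a)"
    by algebra
  then have "(r * cos a - cos t)\<^sup>2 + (r * sin a - sin t)\<^sup>2 = 1 - 2 * r * cos (t - a) + r\<^sup>2"
    by (simp add: cos_diff)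
  then show ?thesis
    by (simp add: circle_param_def circle_dist_def norm_vec_def L2_set_def sum_3)
qed

lemma norm_vector_derivative_circle_param:
  assumes "a < b" "t \<in> {a..b}"
  shows "norm (vector_derivative circle_param (at t within {a..b})) = 1"
proof -
  have eq: "circle_param = (\<lambda>t. cos t *\<^sub>R axis 1 1 + sin t *\<^sub>R axis 2 1)"
    by (simp add: fun_eq_iff circle_param_def vec_eq_iff forall_3 axis_def)
  have "(circle_param has_vector_derivative (- sin t) *\<^sub>R axis 1 1 + cos t *\<^sub>R axis 2 1)
      (at t within {a..b})"
    unfolding eq by (auto intro!: derivative_eq_intros)
  then have "vector_derivative circle_param (at t within {a..b})
      = (- sin t) *\<^sub>R axis 1 1 + cos t *\<^sub>R axis 2 1"
    using assms by (intro vector_derivative_within_closed_interval) auto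
  then show ?thesis
    by (simp add: norm_vec_def L2_set_def sum_3 axis_def)
qed

text \<open>
  A unit vector in the plane is a point of the circle, at angle \<open>a\<close> say. Only the angle between it
  and the source point enters the distance, so \<open>a\<close> shifts a periodic integrand and disappears.
\<close>

lemma radial_potential_eq:
  assumes u: "norm u = 1" "u $ 3 = 0" and r: "\<bar>r\<bar> < 1"
  shows "radial_potential lam u r = - lam * inverse_distance_integral r"
proof -
  have "u \<in> circle_param ` {0..2 * pi}"
    using u by (simp add: circle_param_image)
  then obtain a where a: "0 \<le> a" "a \<le> 2 * pi" "u = circle_param a"
    by auto
  have "radial_potential lam u r = - integral {0..2 * pi} (\<lambda>t. lam * (1 / circle_dist r (t - a)))"
    unfolding radial_potential_def ring_potential_def arclength_integral_def
    by (auto intro!: integral_cong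
        simp: a(3) norm_scaleR_circle_param_minus norm_vector_derivative_circle_param)
  also have "\<dots> = - lam * integral {0..2 * pi} (\<lambda>t. 1 / circle_dist r (t - a))"
    by (subst integral_mult_right) simp
  also have "integral {0..2 * pi} (\<lambda>t. 1 / circle_dist r (t - a)) = inverse_distance_integral r"
    unfolding inverse_distance_integral_def
  proof (rule integral_periodic_shift[OF _ _ a(1,2)])
    show "continuous_on UNIV (\<lambda>t. 1 / circle_dist r t)"
      by (intro continuous_intros) (auto simp: circle_dist_nonzero[OF r])
  qed (simp add: circle_dist_def)
  finally show ?thesis .
qed

section \<open>The potential decreases away from the centre\<close>

lemma inverse_distance_integral_deriv:
  assumes r: "\<bar>r\<bar> < 1"
  shows "(inverse_distance_integral has_real_derivative
      integral {0..2 * pi} (\<lambda>t. (cos t - r) / circle_dist r t ^ 3)) (at r)"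
proof -
  have "((\<lambda>r. integral (cbox 0 (2 * pi)) (\<lambda>t. 1 / circle_dist r t)) has_real_derivative
      integral (cbox 0 (2 * pi)) (\<lambda>t. (cos t - r) / circle_dist r t ^ 3)) (at r within {-1<..<1})"
  proof (rule leibniz_rule_field_derivative)
    fix x t :: real assume "x \<in> {-1<..<1}"
    then have x: "\<bar>x\<bar> < 1" by auto
    show "((\<lambda>x. 1 / circle_dist x t) has_real_derivative (cos t - x) / circle_dist x t ^ 3)
        (at x within {-1<..<1})"
      using circle_dist_nonzero[OF x]
      by (auto intro!: derivative_eq_intros circle_dist_deriv_radius[OF x]
          simp: divide_simps power3_eq_cube)
  next
    fix x :: real assume "x \<in> {-1<..<1}"
    then have x: "\<bar>x\<bar> < 1" by auto
    show "(\<lambda>t. 1 / circle_dist x t) integrable_on cbox 0 (2 * pi)"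
      using circle_dist_nonzero[OF x] by (intro integrable_continuous continuous_intros) auto
  next
    show "continuous_on ({-1<..<1} \<times> cbox 0 (2 * pi)) (\<lambda>(x, t). (cos t - x) / circle_dist x t ^ 3)"
      unfolding case_prod_beta by (intro continuous_intros) (auto intro!: circle_dist_nonzero simp: abs_if)
  qed (use r in auto)
  moreover have "at r within {-1<..<1} = at r"
    using r by (intro at_within_open) auto
  ultimately show ?thesis
    by (simp add: inverse_distance_integral_def[abs_def])
qed

text \<open>
  The identity that trades the sign-changing radial field for a square. It expresses that
  \<open>sin t / circle_dist r t\<close> returns to its initial value after one turn.
\<close>

lemma integral_radial_field_identity:
  assumes r: "\<bar>r\<bar> < 1"
  shows "(1 - r\<^sup>2) * integral {0..2 * pi} (\<lambda>t. (cos t - r) / circle_dist r t ^ 3)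
      = r * integral {0..2 * pi} (\<lambda>t. (cos t - r)\<^sup>2 / circle_dist r t ^ 3)"
proof -
  have ne: "circle_dist r t \<noteq> 0" for t
    by (rule circle_dist_nonzero[OF r])
  have deriv: "((\<lambda>t. sin t / circle_dist r t) has_real_derivative
      (1 - r\<^sup>2) * ((cos t - r) / circle_dist r t ^ 3) - r * ((cos t - r)\<^sup>2 / circle_dist r t ^ 3))
      (at t within S)" for t S
  proof -
    have "((\<lambda>t. sin t / circle_dist r t) has_real_derivative
        (cos t * circle_dist r t - sin t * (r * sin t / circle_dist r t))
          / (circle_dist r t * circle_dist r t)) (at t within S)"
      using ne by (intro DERIV_divide DERIV_sin[THEN has_field_derivative_at_within]
          circle_dist_deriv_angle r)
    also have "(cos t * circle_dist r t - sin t * (r * sin t / circle_dist r t))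
          / (circle_dist r t * circle_dist r t)
        = (cos t * (circle_dist r t)\<^sup>2 - r * (sin t)\<^sup>2) / circle_dist r t ^ 3"
      using ne[of t] by (simp add: field_simps power2_eq_square power3_eq_cube)
    also have "cos t * (circle_dist r t)\<^sup>2 - r * (sin t)\<^sup>2
        = (1 - r\<^sup>2) * (cos t - r) - r * (cos t - r)\<^sup>2"
      by (simp add: circle_dist_square[OF r] sin_squared_eq) (simp add: power2_eq_square algebra_simps)
    finally show ?thesis
      (* Only the outer difference may be split, not the one inside cos t - r. *)
      by (simp add: diff_divide_distrib[of "(1 - r\<^sup>2) * (cos t - r)"])
  qed
  have int: "(\<lambda>t. (cos t - r) / circle_dist r t ^ 3) integrable_on {0..2 * pi}"
      "(\<lambda>t. (cos t - r)\<^sup>2 / circle_dist r t ^ 3) integrable_on {0..2 * pi}"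
    using ne by (auto intro!: integrable_continuous_real continuous_intros)
  have "((\<lambda>t. (1 - r\<^sup>2) * ((cos t - r) / circle_dist r t ^ 3)
        - r * ((cos t - r)\<^sup>2 / circle_dist r t ^ 3)) has_integral
      sin (2 * pi) / circle_dist r (2 * pi) - sin 0 / circle_dist r 0) {0..2 * pi}"
    by (intro fundamental_theorem_of_calculus
        deriv[THEN has_real_derivative_iff_has_vector_derivative[THEN iffD1]]) simp
  then have "((\<lambda>t. (1 - r\<^sup>2) * ((cos t - r) / circle_dist r t ^ 3)
        - r * ((cos t - r)\<^sup>2 / circle_dist r t ^ 3)) has_integral 0) {0..2 * pi}"
    by simp
  moreover have "((\<lambda>t. (1 - r\<^sup>2) * ((cos t - r) / circle_dist r t ^ 3)
        - r * ((cos t - r)\<^sup>2 / circle_dist r t ^ 3)) has_integral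
      (1 - r\<^sup>2) * integral {0..2 * pi} (\<lambda>t. (cos t - r) / circle_dist r t ^ 3)
        - r * integral {0..2 * pi} (\<lambda>t. (cos t - r)\<^sup>2 / circle_dist r t ^ 3)) {0..2 * pi}"
    by (intro has_integral_diff has_integral_mult_right integrable_integral int)
  ultimately have "0 = (1 - r\<^sup>2) * integral {0..2 * pi} (\<lambda>t. (cos t - r) / circle_dist r t ^ 3)
        - r * integral {0..2 * pi} (\<lambda>t. (cos t - r)\<^sup>2 / circle_dist r t ^ 3)"
    by (rule has_integral_unique)
  then show ?thesis
    by linarith
qed

lemma integral_radial_field_pos:
  assumes r: "0 < r" "r < 1"
  shows "0 < integral {0..2 * pi} (\<lambda>t. (cos t - r) / circle_dist r t ^ 3)"
proof -
  have r': "\<bar>r\<bar> < 1" using r by simp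
  let ?f = "\<lambda>t. (cos t - r)\<^sup>2 / circle_dist r t ^ 3"
  have pos: "0 < circle_dist r t" for t
    by (rule circle_dist_pos[OF r'])
  have cont: "continuous_on {0..2 * pi} ?f"
    by (intro continuous_intros) (auto simp: circle_dist_nonzero[OF r'])
  have nonneg: "0 \<le> ?f t" for t
    using pos[of t] by simp
  (* The integrand vanishes where cos t = r, so positivity of the integral needs a point,
     here t = 0, at which it does not. *)
  have "?f 0 \<noteq> 0"
    using r pos[of 0] by simp
  then have "integral {0..2 * pi} ?f \<noteq> 0"
    using integral_eq_0_iff[OF cont _ nonneg] by force
  moreover have "0 \<le> integral {0..2 * pi} ?f"
    using nonneg by (intro integral_nonneg integrable_continuous_real cont) auto
  ultimately have "0 < r * integral {0..2 * pi} ?f"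
    using r by simp
  then have "0 < (1 - r\<^sup>2) * integral {0..2 * pi} (\<lambda>t. (cos t - r) / circle_dist r t ^ 3)"
    by (simp only: integral_radial_field_identity[OF r'])
  moreover have "0 < 1 - r\<^sup>2"
    using r by (simp add: power_less_one_iff)
  ultimately show ?thesis
    by (simp add: zero_less_mult_iff)
qed

section \<open>The potential is unbounded near the circle\<close>

text \<open>
  The triangle inequality through the nearest point of the circle, followed by bounding a chord by
  its arc; in terms of squares, \<open>\<rho>\<^sup>2 = (1 - r)\<^sup>2 + 2 * r * (1 - cos t)\<close> and
  \<open>2 * (1 - cos t) \<le> t\<^sup>2\<close>.
\<close>

lemma circle_dist_le:
  assumes "0 \<le> r" "r < 1" "0 \<le> t"
  shows "circle_dist r t \<le> 1 - r + t"
proof -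
  have "1 - cos t = 2 * (sin (t / 2))\<^sup>2"
    using cos_double_sin[of "t / 2"] by simp
  moreover have "(sin (t / 2))\<^sup>2 \<le> (t / 2)\<^sup>2"
    using abs_sin_x_le_abs_x[of "t / 2"] abs_le_square_iff by blast
  ultimately have "2 * (1 - cos t) \<le> t\<^sup>2"
    by (simp add: power_divide)
  moreover have "r * (2 * (1 - cos t)) \<le> 2 * (1 - cos t)"
    using assms by (intro mult_left_le_one_le) auto
  ultimately have "r * (2 * (1 - cos t)) \<le> t\<^sup>2"
    by linarith
  moreover have "0 \<le> 2 * ((1 - r) * t)"
    using assms by simp
  ultimately have "1 - 2 * r * cos t + r\<^sup>2 \<le> (1 - r + t)\<^sup>2"
    by (simp add: power2_eq_square algebra_simps)
  then show ?thesis
    unfolding circle_dist_def using assms by (intro real_le_lsqrt) auto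
qed

lemma inverse_distance_integral_ge_ln:
  assumes r: "0 \<le> r" "r < 1"
  shows "ln (1 - r + 2 * pi) - ln (1 - r) \<le> inverse_distance_integral r"
proof -
  have pos: "0 < circle_dist r t" for t
    using r by (intro circle_dist_pos) auto
  have "((\<lambda>t. 1 / (1 - r + t)) has_integral ln (1 - r + 2 * pi) - ln (1 - r + 0)) {0..2 * pi}"
    by (intro fundamental_theorem_of_calculus)
      (use r in \<open>auto intro!: derivative_eq_intros
        simp: has_real_derivative_iff_has_vector_derivative[symmetric]\<close>)
  moreover have "((\<lambda>t. 1 / circle_dist r t) has_integral inverse_distance_integral r) {0..2 * pi}"
    unfolding inverse_distance_integral_def
    using r by (intro integrable_integral integrable_continuous_real continuous_intros)
      (auto simp: circle_dist_nonzero)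
  ultimately have "ln (1 - r + 2 * pi) - ln (1 - r + 0) \<le> inverse_distance_integral r"
    by (rule has_integral_le) (use r pos in \<open>auto intro!: divide_left_mono circle_dist_le
        mult_pos_pos add_pos_nonneg\<close>)
  then show ?thesis by simp
qed

lemma inverse_distance_integral_at_top:
  "filterlim inverse_distance_integral at_top (at_left 1)"
proof (rule filterlim_at_top_mono)
  have "filterlim (\<lambda>r::real. 1 - r) (at_right 0) (at_left 1)"
    unfolding filterlim_at
    by (auto intro!: tendsto_eq_intros simp: eventually_at_filter)
  then have "filterlim (\<lambda>r::real. ln (1 - r)) at_bot (at_left 1)"
    by (rule filterlim_compose[OF ln_at_0])
  then have "filterlim (\<lambda>r::real. - ln (1 - r)) at_top (at_left 1)"
    by (simp add: filterlim_uminus_at_top)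
  moreover have "((\<lambda>r. ln (1 - r + 2 * pi)) \<longlongrightarrow> ln (1 - 1 + 2 * pi)) (at_left 1)"
    by (intro tendsto_intros) simp
  ultimately show "filterlim (\<lambda>r. ln (1 - r + 2 * pi) + - ln (1 - r)) at_top (at_left 1)"
    by (intro filterlim_tendsto_add_at_top)
  show "\<forall>\<^sub>F r in at_left 1. ln (1 - r + 2 * pi) + - ln (1 - r) \<le> inverse_distance_integral r"
    using eventually_at_left_real[of 0 "1::real"]
    by (auto elim!: eventually_mono dest: inverse_distance_integral_ge_ln[rotated] simp: less_imp_le)
qed

section \<open>The effective potential\<close>

text \<open>
  The formula covers \<open>r = 0\<close> as well, which supplies the continuity of the potential at the centre.
\<close>

lemma radial_potential_deriv:
  assumes "norm u = 1" "u $ 3 = 0" "\<bar>r\<bar> < 1"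
  shows "(radial_potential lam u has_real_derivative
      - lam * integral {0..2 * pi} (\<lambda>t. (cos t - r) / circle_dist r t ^ 3)) (at r)"
proof (rule has_field_derivative_transform_within_open[where S = "{-1<..<1}"])
  show "((\<lambda>r. - lam * inverse_distance_integral r) has_real_derivative
      - lam * integral {0..2 * pi} (\<lambda>t. (cos t - r) / circle_dist r t ^ 3)) (at r)"
    by (intro DERIV_cmult inverse_distance_integral_deriv assms)
qed (use assms in \<open>auto simp: radial_potential_eq\<close>)

theorem theoremB:
  fixes lam K :: real and u :: "real ^ 3"
  assumes "lam > 0" and "norm u = 1" and "u $ 3 = 0"
  defines "V \<equiv> radial_potential lam u" and "U \<equiv> effective_potential lam K u"
  shows "(\<forall>r. 0 < r \<and> r < 1 \<longrightarrow> (\<exists>D. (V has_real_derivative D) (at r) \<and> D < 0))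
    \<and> (\<forall>r. 0 < r \<and> r < 1 \<longrightarrow> (\<exists>D. (U has_real_derivative D) (at r) \<and> D < 0))
    \<and> filterlim U at_bot (at_left 1)
    \<and> (K \<noteq> 0 \<longrightarrow> filterlim U at_top (at_right 0))
    \<and> (K = 0 \<longrightarrow> (\<forall>r. -1 < r \<and> r < 1 \<longrightarrow> U (- r) = U r))"
proof -
  have U: "U = (\<lambda>r. K\<^sup>2 / (2 * r\<^sup>2) + V r)"
    by (simp add: U_def V_def effective_potential_def fun_eq_iff)
  have decr: "\<exists>D. (V has_real_derivative D) (at r) \<and> D < 0" if r: "0 < r" "r < 1" for r
    using radial_potential_deriv[of u r lam] integral_radial_field_pos[OF r] assms r
    by (auto simp: V_def intro!: exI)
  have decrU: "\<exists>D. (U has_real_derivative D) (at r) \<and> D < 0" if r: "0 < r" "r < 1" for r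
  proof -
    obtain D where D: "(V has_real_derivative D) (at r)" "D < 0"
      using decr[OF r] by blast
    have "((\<lambda>r. K\<^sup>2 / (2 * r\<^sup>2)) has_real_derivative - (K\<^sup>2 / r ^ 3)) (at r)"
      using r by (auto intro!: derivative_eq_intros simp: field_simps power_numeral_reduce)
    then have "(U has_real_derivative - (K\<^sup>2 / r ^ 3) + D) (at r)"
      unfolding U by (intro DERIV_add D)
    moreover have "- (K\<^sup>2 / r ^ 3) + D < 0"
      using r D by (smt (verit) divide_nonneg_pos zero_le_power2 zero_less_power)
    ultimately show ?thesis by blast
  qed
  have bot: "filterlim U at_bot (at_left 1)"
  proof -
    have "filterlim (\<lambda>r. lam * inverse_distance_integral r) at_top (at_left 1)"
      using assms(1) by (intro filterlim_tendsto_pos_mult_at_top[OF tendsto_const]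
          inverse_distance_integral_at_top)
    moreover have "((\<lambda>r. - (K\<^sup>2 / (2 * r\<^sup>2))) \<longlongrightarrow> - (K\<^sup>2 / (2 * 1\<^sup>2))) (at_left 1)"
      by (intro tendsto_intros) simp
    ultimately have "filterlim (\<lambda>r. - (K\<^sup>2 / (2 * r\<^sup>2)) + lam * inverse_distance_integral r)
        at_top (at_left 1)"
      by (intro filterlim_tendsto_add_at_top)
    moreover have "\<forall>\<^sub>F r in at_left 1.
        - (K\<^sup>2 / (2 * r\<^sup>2)) + lam * inverse_distance_integral r = - U r"
      using eventually_at_left_real[of 0 "1::real"]
      by (auto elim!: eventually_mono simp: U V_def radial_potential_eq assms)
    ultimately have "filterlim (\<lambda>r. - U r) at_top (at_left 1)"
      by (rule filterlim_cong[OF refl refl, THEN iffD1, rotated])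
    then show ?thesis
      by (simp add: filterlim_uminus_at_bot)
  qed
  have top: "filterlim U at_top (at_right 0)" if "K \<noteq> 0"
  proof -
    have "isCont V 0"
      using radial_potential_deriv[of u 0 lam] assms DERIV_isCont unfolding V_def by force
    then have "(V \<longlongrightarrow> V 0) (at_right 0)"
      by (simp add: isCont_def filterlim_at_split)
    moreover have "filterlim (\<lambda>r. K\<^sup>2 / (2 * r\<^sup>2)) at_top (at_right 0)"
    proof -
      have "((\<lambda>r::real. 2 * r\<^sup>2 / K\<^sup>2) \<longlongrightarrow> 0) (at_right 0)"
        using that by (auto intro!: tendsto_eq_intros)
      moreover have "\<forall>\<^sub>F r::real in at_right 0. 0 < 2 * r\<^sup>2 / K\<^sup>2"
        using that by (simp add: eventually_at_filter)
      ultimately show ?thesis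
        using filterlim_inverse_at_top[of "\<lambda>r::real. 2 * r\<^sup>2 / K\<^sup>2" "at_right 0"] by simp
    qed
    ultimately have "filterlim (\<lambda>r. V r + K\<^sup>2 / (2 * r\<^sup>2)) at_top (at_right 0)"
      by (intro filterlim_tendsto_add_at_top)
    then show ?thesis
      unfolding U by (simp add: add.commute)
  qed
  have even: "V (- r) = V r" if "-1 < r" "r < 1" for r
  proof -
    have "V (- r) = radial_potential lam (- u) r"
      by (simp add: V_def radial_potential_def)
    also have "\<dots> = V r"
      using that assms by (simp add: V_def radial_potential_eq)
    finally show ?thesis .
  qed
  show ?thesis
    using decr decrU bot top even by (simp add: U)
qed

end
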